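(* Let $n\ge 3$, $p,q>0$, $\alpha\in[2,n)$ and $\sigma_1,\sigma_2\in(-\infty,\alpha)$. Then the system of integral equations $$u(x)=\int_{\mathbb{R}^n}\frac{v(y)^q}{|x-y|^{n-\alpha}|y|^{\sigma_1}}\,dy,\qquad v(x)=\int_{\mathbb{R}^n}\frac{u(y)^p}{|x-y|^{n-\alpha}|y|^{\sigma_2}}\,dy$$ has no positive radial solution if $pq\in(0,1]$, or if $pq>1$ and $$\frac{n-\sigma_1}{1+q}+\frac{n-\sigma_2}{1+p}>n-\alpha.$$
   Context: A positive radial solution is understood to be a pair $(u,v)$ of positive, radially symmetric, decreasing (in $|x|$) functions in $C^{\lfloor\alpha\rfloor}(\mathbb{R}^n\setminus\{0\})\cap C(\mathbb{R}^n)$ satisfying the system, where $\lfloor\cdot\rfloor$ is the greatest integer function. *)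

theory Defs
  imports "HOL-Analysis.Analysis"
begin

text \<open>
  For open \<open>S\<close>, \<open>Ck_on k f S\<close> means that \<open>f\<close> is of class \<open>C\<^sup>k\<close> on \<open>S\<close>: the derivative
  \<open>x \<mapsto> D f(x)\<close> is of class \<open>C\<^sup>k\<^sup>-\<^sup>1\<close> iff all the directional derivatives \<open>x \<mapsto> D f(x) v\<close> are,
  because the space is finite-dimensional.
\<close>

fun Ck_on :: "nat \<Rightarrow> ('a::euclidean_space \<Rightarrow> real) \<Rightarrow> 'a set \<Rightarrow> bool" where
  "Ck_on 0 f S \<longleftrightarrow> continuous_on S f"
| "Ck_on (Suc k) f S \<longleftrightarrow>
     (\<forall>x\<in>S. f differentiable (at x)) \<and>
     (\<forall>v. Ck_on k (\<lambda>x. frechet_derivative f (at x) v) S)"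

definition radially_symmetric :: "('a::real_normed_vector \<Rightarrow> real) \<Rightarrow> bool" where
  "radially_symmetric f \<longleftrightarrow> (\<forall>x y. norm x = norm y \<longrightarrow> f x = f y)"

text \<open>Decreasing is meant in the wide sense, which makes nonexistence the stronger claim.\<close>

definition radially_decreasing :: "('a::real_normed_vector \<Rightarrow> real) \<Rightarrow> bool" where
  "radially_decreasing f \<longleftrightarrow> (\<forall>x y. norm x \<le> norm y \<longrightarrow> f y \<le> f x)"

text \<open>
  The equation \<open>w(x) = \<integral> f(y)\<^sup>r / (|x-y|\<^sup>n\<^sup>-\<^sup>\<alpha> |y|\<^sup>\<sigma>) dy\<close> for all \<open>x\<close>, where the
  (Lebesgue) integral is required to converge. The values at \<open>y = 0\<close> and \<open>y = x\<close>, where the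
  quotient may be a division by zero, are irrelevant.
\<close>

definition riesz_equation ::
  "real \<Rightarrow> real \<Rightarrow> real \<Rightarrow> (real ^ 'n \<Rightarrow> real) \<Rightarrow> (real ^ 'n \<Rightarrow> real) \<Rightarrow> bool" where
  "riesz_equation \<alpha> \<sigma> r f w \<longleftrightarrow>
     (\<forall>x. has_bochner_integral lborel
        (\<lambda>y. f y powr r / (norm (x - y) powr (real CARD('n) - \<alpha>) * norm y powr \<sigma>)) (w x))"

definition positive_radial_solution ::
  "real \<Rightarrow> real \<Rightarrow> real \<Rightarrow> real \<Rightarrow> real \<Rightarrow> (real ^ 'n \<Rightarrow> real) \<Rightarrow> (real ^ 'n \<Rightarrow> real) \<Rightarrow> bool" where
  "positive_radial_solution p q \<alpha> \<sigma>\<^sub>1 \<sigma>\<^sub>2 u v \<longleftrightarrow>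
     (\<forall>w\<in>{u, v}.
        (\<forall>x. w x > 0) \<and> radially_symmetric w \<and> radially_decreasing w \<and>
        Ck_on (nat \<lfloor>\<alpha>\<rfloor>) w (- {0}) \<and> continuous_on UNIV w) \<and>
     riesz_equation \<alpha> \<sigma>\<^sub>1 q v u \<and> riesz_equation \<alpha> \<sigma>\<^sub>2 p u v"

end

theory Submission
  imports Defs
begin

text \<open>
  Write \<open>\<mu>\<^sub>i = |x|\<^bsup>-\<sigma>\<^sub>i\<^esup> dx\<close>, a measure that is homogeneous under dilations, of degree
  \<open>m\<^sub>i = n - \<sigma>\<^sub>i\<close>. Since \<open>v\<close> decreases, restricting the integral for \<open>u(x)\<close> to the ball of radius
  \<open>|x|\<close> gives \<open>u(x) \<ge> k |x|\<^bsup>\<alpha>-\<sigma>\<^sub>1\<^esup> v(x)\<^sup>q\<close>, and similarly for \<open>v\<close>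
  (\<open>riesz_potential_lower_bound\<close>). Substituting one bound into the other gives
  \<open>u \<ge> k |x|\<^sup>A u\<^bsup>pq\<^esup>\<close> with \<open>A > 0\<close>. If \<open>pq \<le> 1\<close>, this forces the bounded function \<open>u\<close> to be
  unbounded (\<open>no_bounded_self_improving\<close>). If \<open>pq > 1\<close>, it is a decay estimate
  \<open>u \<le> C |x|\<^bsup>-A/(pq-1)\<^esup>\<close>, and the inequality assumed between the exponents says precisely that
  this decay makes the energy \<open>E = \<integral> u\<^bsup>p+1\<^esup> d\<mu>\<^sub>2\<close> finite.

  It remains to see that finite energy is incompatible with that inequality, which is what a
  Pohozaev identity does. Here (\<open>riesz_system_finite_energy_exponents\<close>) that identity is replaced
  by its integrated form, which compares the solution with its dilations. Pair the density \<open>u(\<lambda>x)\<^sup>p\<close>, with respect to \<open>\<mu>\<^sub>2\<close>, with the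
  potential \<open>u\<close>; symmetry and homogeneity of the kernel \<open>|x-y|\<^bsup>\<alpha>-n\<^esup>\<close> give the exact identity
  \<open>\<integral> u(\<lambda>x)\<^sup>p u(x) d\<mu>\<^sub>2 = \<lambda>\<^bsup>\<sigma>\<^sub>2-\<alpha>\<^esup> \<integral> v(y)\<^sup>q v(\<lambda>y) d\<mu>\<^sub>1\<close>
  for all \<open>\<lambda> > 0\<close> (\<open>riesz_pairing_scale\<close>). At \<open>\<lambda> = 1\<close> it says that both components have the same
  energy \<open>E\<close>. Young's inequality bounds the right-hand integral above by
  \<open>E (q + \<lambda>\<^bsup>-m\<^sub>1\<^esup>)/(q + 1)\<close>, and it would bound the left-hand one above by
  \<open>E (p \<lambda>\<^bsup>-m\<^sub>2\<^esup> + 1)/(p + 1)\<close>; the latter bound is attained to first order as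
  \<open>\<lambda> \<down> 1\<close> (\<open>scaled_energy_lower_bound\<close>). Comparing the derivatives at \<open>\<lambda> = 1\<close> gives
  \<open>(n-\<sigma>\<^sub>1)/(1+q) + (n-\<sigma>\<^sub>2)/(1+p) \<le> n-\<alpha>\<close>.

  That the defect in Young's inequality is \<open>o(\<lambda> - 1)\<close> comes from monotonicity and continuity of
  \<open>u\<close>. With \<open>a = u(\<lambda>x) \<le> b = u(x)\<close> the defect is at most
  \<open>(1 - a/b) (b\<^bsup>p+1\<^esup> - a\<^bsup>p+1\<^esup>)\<close> (\<open>Young_powr_deficit\<close>). The second factor is nonnegative and has
  integral \<open>(1 - \<lambda>\<^bsup>-m\<^sub>2\<^esup>) E = O(\<lambda> - 1)\<close>. The first one tends to \<open>0\<close> uniformly on every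
  ball, by uniform continuity, and far out only a small fraction of the integral of the second
  factor remains (\<open>tail_scaling_defect_le\<close>).
\<close>

section \<open>Homogeneous measures\<close>

definition power_measure :: "real \<Rightarrow> 'a::euclidean_space measure" where
  "power_measure \<sigma> = density lborel (\<lambda>x. ennreal (norm x powr - \<sigma>))"

lemma sets_power_measure [simp, measurable_cong]: "sets (power_measure \<sigma>) = sets borel"
  and space_power_measure [simp]: "space (power_measure \<sigma>) = UNIV"
  by (simp_all add: power_measure_def)

lemma borel_measurable_power_measure [simp]:
  "borel_measurable (power_measure \<sigma>) = borel_measurable borel"
  by (rule measurable_cong_sets) simp_all

lemma nn_integral_power_measure:
  fixes h :: "'a::euclidean_space \<Rightarrow> ennreal"
  assumes [measurable]: "h \<in> borel_measurable borel"
  shows "(\<integral>\<^sup>+x. h x \<partial>power_measure \<sigma>) = (\<integral>\<^sup>+x. ennreal (norm x powr - \<sigma>) * h x \<partial>lborel)"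
  unfolding power_measure_def by (rule nn_integral_density) auto

text \<open>
  Homogeneity replaces integration in polar coordinates throughout: it gives the measure of every
  ball in terms of the measure \<open>c\<close> of the unit ball. That \<open>c\<close> is finite amounts to \<open>\<sigma> < n\<close>, but
  it is carried as a hypothesis below, since a solution of the system yields it at once.
\<close>

lemma nn_integral_power_measure_scale:
  fixes h :: "'a::euclidean_space \<Rightarrow> ennreal"
  assumes [measurable]: "h \<in> borel_measurable borel" and l: "0 < l"
  shows "(\<integral>\<^sup>+x. h (l *\<^sub>R x) \<partial>power_measure \<sigma>)
       = ennreal (l powr - (real DIM('a) - \<sigma>)) * (\<integral>\<^sup>+x. h x \<partial>power_measure \<sigma>)"
proof -
  let ?g = "\<lambda>x::'a. ennreal (norm x powr - \<sigma>) * h x"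
  have "(\<integral>\<^sup>+x. ?g x \<partial>lborel)
      = (\<integral>\<^sup>+x. ?g x \<partial>density (distr lborel borel (\<lambda>x. 0 + l *\<^sub>R x)) (\<lambda>_. ennreal (\<bar>l\<bar> ^ DIM('a))))"
    using lborel_affine[of l "0::'a"] l by simp
  also have "\<dots> = ennreal (l ^ DIM('a)) * (\<integral>\<^sup>+x. ?g (l *\<^sub>R x) \<partial>lborel)"
    using l by (simp add: nn_integral_density nn_integral_distr nn_integral_cmult)
  also have "(\<integral>\<^sup>+x. ?g (l *\<^sub>R x) \<partial>lborel)
      = ennreal (l powr - \<sigma>) * (\<integral>\<^sup>+x. ennreal (norm x powr - \<sigma>) * h (l *\<^sub>R x) \<partial>lborel)"
    using l by (subst nn_integral_cmult[symmetric])
      (auto simp: powr_mult ennreal_mult' mult.assoc intro!: nn_integral_cong)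
  finally have "(\<integral>\<^sup>+x. h x \<partial>power_measure \<sigma>)
      = ennreal (l powr (real DIM('a) - \<sigma>)) * (\<integral>\<^sup>+x. h (l *\<^sub>R x) \<partial>power_measure \<sigma>)"
    using l by (simp add: nn_integral_power_measure mult.assoc[symmetric]
        ennreal_mult'[symmetric] powr_realpow[symmetric] powr_add[symmetric])
  then show ?thesis
    using l by (simp add: mult.assoc[symmetric] ennreal_mult'[symmetric] powr_add[symmetric])
qed

lemma emeasure_power_measure_cball:
  assumes "0 < R"
  shows "emeasure (power_measure \<sigma>) (cball 0 R :: 'a::euclidean_space set)
       = ennreal (R powr (real DIM('a) - \<sigma>)) * emeasure (power_measure \<sigma>) (cball 0 1 :: 'a set)"
proof -
  have *: "indicator (cball 0 1) ((1/R) *\<^sub>R x) = (indicator (cball 0 R) x :: ennreal)" for x :: 'a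
    using assms by (auto simp: indicator_def field_simps)
  show ?thesis
    using nn_integral_power_measure_scale[of "indicator (cball 0 1 :: 'a set)" "1/R" \<sigma>] assms
      borel_measurable_indicator[of "cball 0 1 :: 'a set" borel]
    unfolding * by (simp add: powr_divide powr_minus_divide[of R "real DIM('a) - \<sigma>", simplified])
qed

lemma emeasure_power_measure_cball_pos:
  "0 < emeasure (power_measure \<sigma>) (cball 0 1 :: 'a::euclidean_space set)"
proof (rule ccontr)
  note [measurable] = borel_closed[OF closed_cball[of "0::'a" 1]]
  assume "\<not> ?thesis"
  then have "emeasure (power_measure \<sigma>) (cball 0 1 :: 'a set) = 0"
    by (simp add: not_less)
  then have "(\<integral>\<^sup>+x. ennreal (norm x powr - \<sigma>) * indicator (cball 0 1 :: 'a set) x \<partial>lborel) = 0"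
    using nn_integral_power_measure[of "indicator (cball 0 1 :: 'a set)" \<sigma>]
      borel_measurable_indicator[of "cball 0 1 :: 'a set" borel] by simp
  then have "AE x in lborel. ennreal (norm x powr - \<sigma>) * indicator (cball 0 1 :: 'a set) x = 0"
    by (subst (asm) nn_integral_0_iff_AE) measurable
  moreover have "AE x in lborel. x \<noteq> (0::'a)"
    by (rule AE_lborel_singleton)
  ultimately have "AE x in lborel. x \<notin> (cball 0 1 :: 'a set)"
    by eventually_elim (auto simp: indicator_def split: if_splits)
  then have "emeasure lborel (cball 0 1 :: 'a set) = 0"
    by (subst (asm) AE_iff_measurable[OF _ refl]) (auto simp: cball_def)
  then show False
    using content_cball_pos[of 1 "0::'a"] by (simp add: measure_def)
qed

lemma AE_power_measure_neq: "AE y in power_measure \<sigma>. y \<noteq> (x :: 'a::euclidean_space)"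
  unfolding power_measure_def
  by (subst AE_density) (use AE_lborel_singleton[of x] in \<open>auto elim: eventually_mono\<close>)

lemma sigma_finite_power_measure:
  "sigma_finite_measure (power_measure \<sigma> :: 'a::euclidean_space measure)"
  unfolding power_measure_def
  by (subst sigma_finite_measure.sigma_finite_iff_density_finite'[OF sigma_finite_lborel]) auto

lemma integral_power_measure_scale:
  fixes h :: "'a::euclidean_space \<Rightarrow> real"
  assumes [measurable]: "h \<in> borel_measurable borel" and h: "\<And>x. 0 \<le> h x"
    and int: "integrable (power_measure \<sigma>) h" and l: "0 < l"
  shows "integrable (power_measure \<sigma>) (\<lambda>x. h (l *\<^sub>R x))"
    and "(\<integral>x. h (l *\<^sub>R x) \<partial>power_measure \<sigma>)
       = l powr - (real DIM('a) - \<sigma>) * (\<integral>x. h x \<partial>power_measure \<sigma>)"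
proof -
  have *: "(\<integral>\<^sup>+x. ennreal (h (l *\<^sub>R x)) \<partial>power_measure \<sigma>)
      = ennreal (l powr - (real DIM('a) - \<sigma>) * (\<integral>x. h x \<partial>power_measure \<sigma>))"
    using nn_integral_power_measure_scale[of "\<lambda>x. ennreal (h x)" l \<sigma>] l h
      nn_integral_eq_integral[OF int]
    by (simp add: ennreal_mult')
  show int': "integrable (power_measure \<sigma>) (\<lambda>x. h (l *\<^sub>R x))"
    by (rule integrableI_nn_integral_finite[OF _ _ *]) (use h in auto)
  show "(\<integral>x. h (l *\<^sub>R x) \<partial>power_measure \<sigma>)
       = l powr - (real DIM('a) - \<sigma>) * (\<integral>x. h x \<partial>power_measure \<sigma>)"
    by (rule integral_eq_nn_integral[THEN trans]) (use h in \<open>auto simp: *\<close>)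
qed

lemma measure_power_measure_shell:
  fixes \<sigma> :: real
  defines "c \<equiv> measure (power_measure \<sigma>) (cball 0 1 :: 'a::euclidean_space set)"
  assumes fin: "emeasure (power_measure \<sigma>) (cball 0 1 :: 'a set) < \<infinity>" and "0 < r" "r \<le> s"
  shows "cball 0 s - cball 0 r \<in> fmeasurable (power_measure \<sigma> :: 'a measure)"
    and "measure (power_measure \<sigma>) (cball 0 s - cball 0 r :: 'a set)
       = c * (s powr (real DIM('a) - \<sigma>) - r powr (real DIM('a) - \<sigma>))"
proof -
  have ball: "cball 0 R \<in> fmeasurable (power_measure \<sigma> :: 'a measure)"
    "measure (power_measure \<sigma>) (cball 0 R :: 'a set) = c * R powr (real DIM('a) - \<sigma>)"
    if "0 < R" for R
    using that fin by (auto simp: fmeasurable_def emeasure_power_measure_cball[of R]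
        ennreal_mult_less_top measure_def c_def enn2real_mult)
  show "cball 0 s - cball 0 r \<in> fmeasurable (power_measure \<sigma> :: 'a measure)"
    using ball[of s] ball[of r] assms by (intro fmeasurable_Diff) auto
  have "measure (power_measure \<sigma>) (cball 0 s - cball 0 r :: 'a set)
      = measure (power_measure \<sigma>) (cball 0 s :: 'a set) - measure (power_measure \<sigma>) (cball 0 r :: 'a set)"
    using ball(1)[of s] ball(1)[of r] assms
    by (intro measurable_measure_Diff) auto
  then show "measure (power_measure \<sigma>) (cball 0 s - cball 0 r :: 'a set)
       = c * (s powr (real DIM('a) - \<sigma>) - r powr (real DIM('a) - \<sigma>))"
    using ball(2)[of s] ball(2)[of r] assms by (simp add: algebra_simps)
qed

text \<open>
  A function that decays faster than the critical rate \<open>n - \<sigma>\<close> is dominated by a series of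
  indicators of dyadic balls, whose integrals form a convergent geometric series by homogeneity.
\<close>

lemma nn_integral_power_measure_decay_finite:
  fixes F :: "'a::euclidean_space \<Rightarrow> real"
  assumes [measurable]: "F \<in> borel_measurable borel"
    and fin: "emeasure (power_measure \<sigma>) (cball 0 1 :: 'a set) < \<infinity>"
    and bdd: "\<And>x. F x \<le> M"
    and decay: "\<And>x. x \<noteq> 0 \<Longrightarrow> F x \<le> C * norm x powr - s"
    and s: "real DIM('a) - \<sigma> < s" "0 < s" "0 \<le> C"
  shows "(\<integral>\<^sup>+x. ennreal (F x) \<partial>power_measure \<sigma>) < \<infinity>"
proof -
  let ?m = "real DIM('a) - \<sigma>"
  let ?c = "emeasure (power_measure \<sigma>) (cball 0 1 :: 'a set)"
  define B where "B k = (cball 0 (2 powr real (Suc k)) :: 'a set)" for k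
  define t where "t k = C * 2 powr (- s * real k)" for k
  have [measurable]: "cball 0 1 \<in> sets (borel :: 'a measure)" "B k \<in> sets borel" for k
    by (simp_all add: B_def)
  have term_le: "h k \<le> suminf h" for h :: "nat \<Rightarrow> ennreal" and k
    using sum_le_suminf[of h "{k}"] by simp
  have "ennreal (F x) \<le> ennreal M * indicator (cball 0 1) x + (\<Sum>k. ennreal (t k) * indicator (B k) x)" for x
  proof (cases "norm x \<le> 1")
    case True
    then show ?thesis
      using bdd[of x] by (auto simp: indicator_def intro!: add_increasing2 ennreal_leI)
  next
    case False
    define k where "k = nat \<lfloor>log 2 (norm x)\<rfloor>"
    have "0 < log 2 (norm x)"
      using False by (subst zero_less_log_cancel_iff) auto
    then have k: "real k \<le> log 2 (norm x)" "log 2 (norm x) \<le> real (Suc k)"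
      unfolding k_def by linarith+
    then have k': "2 powr real k \<le> norm x" "norm x \<le> 2 powr real (Suc k)"
      using False le_log_iff[of 2 "norm x" "real k"] log_le_iff[of 2 "norm x" "real (Suc k)"]
      by (auto simp del: of_nat_Suc zero_less_norm_iff)
    have "F x \<le> C * norm x powr - s"
      using False by (intro decay) auto
    also have "\<dots> \<le> C * (2 powr real k) powr - s"
      using k'(1) s by (intro mult_left_mono powr_mono2') auto
    finally have "ennreal (F x) \<le> ennreal (t k) * indicator (B k) x"
      using k'(2) by (auto simp: t_def B_def powr_powr mult_ac intro!: ennreal_leI)
    also have "\<dots> \<le> (\<Sum>k. ennreal (t k) * indicator (B k) x)"
      by (rule term_le)
    finally show ?thesis
      by (rule add_increasing[OF zero_le])
  qed
  then have "(\<integral>\<^sup>+x. ennreal (F x) \<partial>power_measure \<sigma>)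
      \<le> (\<integral>\<^sup>+x. ennreal M * indicator (cball 0 1) x + (\<Sum>k. ennreal (t k) * indicator (B k) x) \<partial>power_measure \<sigma>)"
    by (intro nn_integral_mono)
  also have "\<dots> = ennreal M * ?c + (\<Sum>k. ennreal (t k) * emeasure (power_measure \<sigma>) (B k))"
    by (subst nn_integral_add) (simp_all add: nn_integral_suminf nn_integral_cmult_indicator)
  also have "(\<Sum>k. ennreal (t k) * emeasure (power_measure \<sigma>) (B k))
      = (\<Sum>k. ennreal (C * 2 powr ?m * (2 powr (?m - s)) ^ k) * ?c)"
  proof (intro suminf_cong)
    fix k
    have "t k * (2 powr real (Suc k)) powr ?m = C * 2 powr ?m * (2 powr (?m - s)) ^ k"
      by (simp add: t_def powr_powr powr_realpow[symmetric] powr_add[symmetric] algebra_simps)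
    moreover have "ennreal (t k) * emeasure (power_measure \<sigma>) (B k)
        = ennreal (t k * (2 powr real (Suc k)) powr ?m) * ?c"
      using emeasure_power_measure_cball[of "2 powr real (Suc k)" \<sigma>, where 'a='a] s(3)
      by (simp add: B_def mult.assoc[symmetric] ennreal_mult'[symmetric] ennreal_mult''[symmetric] t_def del: of_nat_Suc)
    ultimately show "ennreal (t k) * emeasure (power_measure \<sigma>) (B k)
        = ennreal (C * 2 powr ?m * (2 powr (?m - s)) ^ k) * ?c"
      by simp
  qed
  also have "\<dots> = (\<Sum>k. ennreal (C * 2 powr ?m * (2 powr (?m - s)) ^ k)) * ?c"
    by (rule ennreal_suminf_multc)
  also have "(\<Sum>k. ennreal (C * 2 powr ?m * (2 powr (?m - s)) ^ k))
      = ennreal (\<Sum>k. C * 2 powr ?m * (2 powr (?m - s)) ^ k)"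
  proof (rule suminf_ennreal2)
    have "2 powr (?m - s) < 1"
      using s(1) by (simp add: powr_less_one)
    then show "summable (\<lambda>k. C * 2 powr ?m * (2 powr (?m - s)) ^ k)"
      by (intro summable_mult summable_geometric) auto
  qed (use s in auto)
  finally show ?thesis
    using fin by (auto simp: ennreal_mult_less_top elim!: le_less_trans)
qed

section \<open>Lower bounds for Riesz potentials and their consequences\<close>

text \<open>
  With the weight absorbed into the measure, the equation becomes a statement on nonnegative
  integrals, to which Tonelli's theorem and homogeneity apply without integrability conditions.
\<close>

lemma nn_integral_riesz_equation:
  fixes f w :: "real ^ 'n \<Rightarrow> real"
  assumes "riesz_equation \<alpha> \<sigma> r f w" "f \<in> borel_measurable borel"
  shows "(\<integral>\<^sup>+y. ennreal (f y powr r * norm (x - y) powr (\<alpha> - real DIM(real ^ 'n))) \<partial>power_measure \<sigma>)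
       = ennreal (w x)"
proof -
  note [measurable] = assms(2)
  let ?g = "\<lambda>y. f y powr r / (norm (x - y) powr (real CARD('n) - \<alpha>) * norm y powr \<sigma>)"
  have I: "has_bochner_integral lborel ?g (w x)"
    using assms(1) by (simp add: riesz_equation_def)
  have "(\<integral>\<^sup>+y. ennreal (f y powr r * norm (x - y) powr (\<alpha> - real DIM(real ^ 'n))) \<partial>power_measure \<sigma>)
      = (\<integral>\<^sup>+y. ennreal (?g y) \<partial>lborel)"
    by (auto simp: nn_integral_power_measure ennreal_mult'[symmetric] powr_minus_divide
        powr_minus_divide[of _ "real CARD('n) - \<alpha>", simplified] mult_ac intro!: nn_integral_cong)
  also have "\<dots> = ennreal (w x)"
    using I by (subst nn_integral_eq_integral) (auto simp: has_bochner_integral_iff)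
  finally show ?thesis .
qed

text \<open>
  Keep only the ball \<open>|y| \<le> |x|\<close> in the integral: there \<open>f(y) \<ge> f(x)\<close>, and \<open>|x-y| \<le> 2|x|\<close>
  bounds the kernel below. As the potential \<open>w(x)\<close> is finite, so is the measure of the ball.
\<close>

lemma riesz_potential_lower_bound:
  fixes f w :: "'a::euclidean_space \<Rightarrow> real"
  assumes riesz: "\<And>x. (\<integral>\<^sup>+y. ennreal (f y powr r * norm (x - y) powr (\<alpha> - real DIM('a))) \<partial>power_measure \<sigma>)
      = ennreal (w x)"
    and pos: "\<And>x. 0 < f x" "\<And>x. 0 < w x"
    and dec: "radially_decreasing f" and "0 < r" "\<alpha> < real DIM('a)"
  shows "emeasure (power_measure \<sigma>) (cball 0 1 :: 'a set) < \<infinity>"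
    and "\<exists>k>0. \<forall>x. x \<noteq> 0 \<longrightarrow> k * norm x powr (\<alpha> - \<sigma>) * f x powr r \<le> w x"
proof -
  let ?e = "\<alpha> - real DIM('a)" and ?m = "real DIM('a) - \<sigma>"
  let ?c = "emeasure (power_measure \<sigma>) (cball 0 1 :: 'a set)"
  have key: "ennreal (f x powr r * (2 * norm x) powr ?e * norm x powr ?m) * ?c \<le> ennreal (w x)"
    if "x \<noteq> 0" for x
  proof -
    have "ennreal (f x powr r * (2 * norm x) powr ?e * norm x powr ?m) * ?c
        = (\<integral>\<^sup>+y. ennreal (f x powr r * (2 * norm x) powr ?e) * indicator (cball 0 (norm x) :: 'a set) y \<partial>power_measure \<sigma>)"
      using that by (subst nn_integral_cmult_indicator)
        (simp_all add: emeasure_power_measure_cball[of "norm x" \<sigma>] ennreal_mult' mult.assoc)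
    also have "\<dots> \<le> (\<integral>\<^sup>+y. ennreal (f y powr r * norm (x - y) powr ?e) \<partial>power_measure \<sigma>)"
    \<comment> \<open>At \<open>y = x\<close> the kernel has the value \<open>0 powr (\<alpha> - n) = 0\<close>, so the bound holds only almost everywhere.\<close>
    proof (rule nn_integral_mono_AE, use AE_power_measure_neq[of x \<sigma>] in eventually_elim)
      fix y assume "y \<noteq> x"
      have "f x powr r * (2 * norm x) powr ?e \<le> f y powr r * norm (x - y) powr ?e"
        if y: "norm y \<le> norm x"
      proof (intro mult_mono)
        show "f x powr r \<le> f y powr r"
          using dec y pos(1)[of x] \<open>0 < r\<close> by (intro powr_mono2) (auto simp: radially_decreasing_def)
        have "norm (x - y) \<le> 2 * norm x"
          using norm_triangle_ineq4[of x y] y by linarith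
        then show "(2 * norm x) powr ?e \<le> norm (x - y) powr ?e"
          using \<open>y \<noteq> x\<close> \<open>\<alpha> < real DIM('a)\<close> by (intro powr_mono2') auto
      qed auto
      then show "ennreal (f x powr r * (2 * norm x) powr ?e) * indicator (cball 0 (norm x)) y
          \<le> ennreal (f y powr r * norm (x - y) powr ?e)"
        by (auto simp: indicator_def intro!: ennreal_leI)
    qed
    also have "\<dots> = ennreal (w x)"
      by (rule riesz)
    finally show ?thesis .
  qed
  obtain b :: 'a where "b \<in> Basis"
    using nonempty_Basis by blast
  then have b: "b \<noteq> 0"
    by auto
  show fin: "?c < \<infinity>"
  proof (rule ccontr)
    assume "\<not> ?c < \<infinity>"
    then have "?c = \<infinity>"
      by (simp add: less_top[symmetric])
    then show False
      using key[OF b] b pos(1)[of b] by (simp add: ennreal_mult_top top_unique)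
  qed
  define c where "c = measure (power_measure \<sigma>) (cball 0 1 :: 'a set)"
  have c: "?c = ennreal c"
    using fin by (simp add: c_def emeasure_eq_ennreal_measure less_top[symmetric])
  have "0 < c"
    using emeasure_power_measure_cball_pos[of \<sigma>, where 'a='a] c by (simp add: ennreal_less_zero_iff)
  show "\<exists>k>0. \<forall>x. x \<noteq> 0 \<longrightarrow> k * norm x powr (\<alpha> - \<sigma>) * f x powr r \<le> w x"
  proof (intro exI[of _ "2 powr ?e * c"] conjI allI impI)
    fix x :: 'a assume "x \<noteq> 0"
    have "f x powr r * (2 * norm x) powr ?e * norm x powr ?m * c \<le> w x"
      using key[OF \<open>x \<noteq> 0\<close>] pos(2)[of x] \<open>0 < c\<close> by (simp add: c ennreal_mult'[symmetric])
    moreover have "norm x powr (\<alpha> - \<sigma>) = norm x powr ?e * norm x powr ?m"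
      by (simp add: powr_add[symmetric])
    ultimately show "2 powr ?e * c * norm x powr (\<alpha> - \<sigma>) * f x powr r \<le> w x"
      by (simp add: powr_mult mult_ac)
  qed (use \<open>0 < c\<close> in simp)
qed

text \<open>
  Eliminating \<open>v\<close> from the two lower bounds leaves an inequality between \<open>u\<close> and a power of
  itself, from which the two lemmas after it draw opposite conclusions: growth or decay, according
  to whether that power is at most \<open>1\<close> or larger.
\<close>

lemma mutual_lower_bounds_compose:
  fixes u v :: "'a::real_normed_vector \<Rightarrow> real"
  assumes "\<exists>k>0. \<forall>x. x \<noteq> 0 \<longrightarrow> k * norm x powr a * v x powr q \<le> u x"
    and "\<exists>k>0. \<forall>x. x \<noteq> 0 \<longrightarrow> k * norm x powr b * u x powr p \<le> v x"
    and q: "0 < q"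
  shows "\<exists>k>0. \<forall>x. x \<noteq> 0 \<longrightarrow> k * norm x powr (a + q * b) * u x powr (p * q) \<le> u x"
proof -
  obtain k where "0 < k" and k: "\<And>x. x \<noteq> 0 \<Longrightarrow> k * norm x powr a * v x powr q \<le> u x"
    using assms(1) by blast
  obtain j where "0 < j" and j: "\<And>x. x \<noteq> 0 \<Longrightarrow> j * norm x powr b * u x powr p \<le> v x"
    using assms(2) by blast
  have "k * j powr q * norm x powr (a + q * b) * u x powr (p * q) \<le> u x" if "x \<noteq> 0" for x
  proof -
    have "k * j powr q * norm x powr (a + q * b) * u x powr (p * q)
        = k * norm x powr a * (j * norm x powr b * u x powr p) powr q"
      using \<open>0 < j\<close> by (simp add: powr_mult powr_powr powr_add mult_ac)
    also have "\<dots> \<le> k * norm x powr a * v x powr q"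
      using j[OF that] q \<open>0 < k\<close> \<open>0 < j\<close> by (intro mult_left_mono powr_mono2) auto
    also have "\<dots> \<le> u x"
      by (rule k[OF that])
    finally show ?thesis .
  qed
  then show ?thesis
    using \<open>0 < k\<close> \<open>0 < j\<close> by (intro exI[of _ "k * j powr q"]) auto
qed

lemma no_bounded_self_improving:
  fixes u :: "'a::euclidean_space \<Rightarrow> real"
  assumes "\<exists>k>0. \<forall>x. x \<noteq> 0 \<longrightarrow> k * norm x powr A * u x powr s \<le> u x"
    and pos: "\<And>x. 0 < u x" and bdd: "\<And>x. u x \<le> M" and "0 < A" "s \<le> 1"
  shows False
proof -
  obtain k where "0 < k" and k: "\<And>x. x \<noteq> 0 \<Longrightarrow> k * norm x powr A * u x powr s \<le> u x"
    using assms(1) by blast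
  obtain b :: 'a where b: "b \<in> Basis"
    using nonempty_Basis by blast
  define B where "B = M powr (1 - s) + 1"
  \<comment> \<open>The radius \<open>t\<close> with \<open>k t\<^sup>A = B\<close>, where the hypothesis reads \<open>u\<^bsup>1-s\<^esup> \<ge> B\<close>.\<close>
  define t where "t = (B / k) powr (1 / A)"
  have "0 < B"
    by (simp add: B_def add_nonneg_pos)
  then have "0 < t"
    using \<open>0 < k\<close> by (simp add: t_def)
  have t: "t powr A = B / k"
    using \<open>0 < A\<close> \<open>0 < B\<close> \<open>0 < k\<close> by (simp add: t_def powr_powr)
  let ?x = "t *\<^sub>R b"
  have "?x \<noteq> 0" "norm ?x = t"
    using b \<open>0 < t\<close> by auto
  then have "B * u ?x powr s \<le> u ?x powr (1 - s) * u ?x powr s"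
    using k[of ?x] t \<open>0 < k\<close> pos[of ?x] by (simp add: powr_add[symmetric])
  then have "B \<le> u ?x powr (1 - s)"
    using pos[of ?x] by simp
  also have "\<dots> \<le> M powr (1 - s)"
    using bdd[of ?x] pos[of ?x] \<open>s \<le> 1\<close> by (intro powr_mono2) auto
  finally show False
    by (simp add: B_def)
qed

lemma self_improving_decay:
  fixes u :: "'a::real_normed_vector \<Rightarrow> real"
  assumes "\<exists>k>0. \<forall>x. x \<noteq> 0 \<longrightarrow> k * norm x powr A * u x powr s \<le> u x"
    and pos: "\<And>x. 0 < u x" and s: "1 < s"
  shows "\<exists>C>0. \<forall>x. x \<noteq> 0 \<longrightarrow> u x \<le> C * norm x powr - (A / (s - 1))"
proof -
  obtain k where "0 < k" and k: "\<And>x. x \<noteq> 0 \<Longrightarrow> k * norm x powr A * u x powr s \<le> u x"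
    using assms(1) by blast
  have "u x \<le> k powr - (1 / (s - 1)) * norm x powr - (A / (s - 1))" if "x \<noteq> 0" for x
  proof -
    have "(k * norm x powr A * u x powr (s - 1)) * u x \<le> 1 * u x"
      using k[OF that] pos[of x] by (simp add: powr_diff)
    then have "k * norm x powr A * u x powr (s - 1) \<le> 1"
      using pos[of x] by (simp only: mult_le_cancel_right_pos)
    then have "u x powr (s - 1) \<le> k powr -1 * norm x powr - A"
      using \<open>0 < k\<close> that by (simp add: powr_minus field_simps)
    then have "(u x powr (s - 1)) powr (1 / (s - 1)) \<le> (k powr -1 * norm x powr - A) powr (1 / (s - 1))"
      using s by (intro powr_mono2) auto
    then show ?thesis
      using s pos[of x] \<open>0 < k\<close> by (simp add: powr_powr powr_divide powr_minus_divide[of k])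
  qed
  then show ?thesis
    using \<open>0 < k\<close> by (intro exI[of _ "k powr - (1 / (s - 1))"]) auto
qed

section \<open>Young's inequality and its defect\<close>

lemma Young_powr:
  fixes a b p :: real
  assumes "0 < a" "0 < b" "0 < p"
  shows "a powr p * b \<le> p / (p + 1) * a powr (p + 1) + 1 / (p + 1) * b powr (p + 1)"
proof -
  have "(a powr (p + 1)) powr (p / (p + 1)) * (b powr (p + 1)) powr (1 / (p + 1))
      \<le> p / (p + 1) * a powr (p + 1) + 1 / (p + 1) * b powr (p + 1)"
    using assms by (intro Youngs_inequality_0) (auto simp: field_simps)
  then show ?thesis
    using assms by (simp add: powr_powr)
qed

text \<open>
  Replacing \<open>a\<^bsup>p+1\<^esup>\<close> by the larger \<open>a\<^sup>p b\<close> on the left turns the product into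
  \<open>(b - a) (b\<^sup>p - a\<^sup>p)\<close>, and then the claim is Young's inequality for \<open>b\<^sup>p a\<close>. The point of the
  form chosen is that the difference \<open>b\<^bsup>p+1\<^esup> - a\<^bsup>p+1\<^esup>\<close> has an integral that homogeneity computes,
  while \<open>1 - a/b\<close> becomes small.
\<close>

lemma Young_powr_deficit:
  fixes a b p :: real
  assumes "0 < a" "a \<le> b" "0 < p"
  shows "p / (p + 1) * a powr (p + 1) + 1 / (p + 1) * b powr (p + 1)
      - (1 - a / b) * (b powr (p + 1) - a powr (p + 1)) \<le> a powr p * b"
proof -
  have b: "0 < b"
    using assms by simp
  have split: "a powr (p + 1) = a powr p * a" "b powr (p + 1) = b powr p * b"
    using assms b by (simp_all add: powr_add)
  have "(1 - a / b) * (b powr (p + 1) - a powr p * b) \<le> (1 - a / b) * (b powr (p + 1) - a powr (p + 1))"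
    using assms b by (intro mult_left_mono) (auto simp: split)
  moreover have "(1 - a / b) * (b powr (p + 1) - a powr p * b)
      = b powr (p + 1) - a powr p * b - b powr p * a + a powr (p + 1)"
    using b unfolding split by (simp add: field_simps)
  moreover have "b powr p * a \<le> p / (p + 1) * b powr (p + 1) + 1 / (p + 1) * a powr (p + 1)"
    using Young_powr[of b a p] assms b by simp
  moreover have "p / (p + 1) * a powr (p + 1) + 1 / (p + 1) * a powr (p + 1) = a powr (p + 1)"
    "p / (p + 1) * b powr (p + 1) + 1 / (p + 1) * b powr (p + 1) = b powr (p + 1)"
    using assms by (simp_all add: divide_simps) (simp_all add: algebra_simps)
  ultimately show ?thesis
    by linarith
qed

section \<open>First-order behaviour of the energy under dilations\<close>

lemma tail_integral_small:
  fixes F :: "'a::euclidean_space \<Rightarrow> real"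
  assumes int: "integrable (power_measure \<sigma>) F" and "0 < \<epsilon>"
  obtains R where "0 < R" "(\<integral>x. indicator (- cball 0 R) x * F x \<partial>power_measure \<sigma>) < \<epsilon>"
proof -
  have "(\<lambda>n. \<integral>x. indicator (- cball 0 (real n)) x * F x \<partial>power_measure \<sigma>)
      \<longlonglongrightarrow> (\<integral>x. 0 \<partial>(power_measure \<sigma> :: 'a measure))"
  proof (rule integral_dominated_convergence[where w = "\<lambda>x. norm (F x)"])
    show "AE x in power_measure \<sigma>. (\<lambda>n. indicator (- cball 0 (real n)) x * F x) \<longlonglongrightarrow> 0"
    proof (rule AE_I2, rule tendsto_eventually)
      fix x :: 'a
      show "\<forall>\<^sub>F n in sequentially. indicator (- cball 0 (real n)) x * F x = 0"
        using eventually_ge_at_top[of "nat \<lceil>norm x\<rceil>"]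
        by eventually_elim (auto simp: indicator_def)
    qed
    show "(\<lambda>x. indicator (- cball 0 (real n)) x * F x) \<in> borel_measurable (power_measure \<sigma>)" for n
      using borel_measurable_integrable[OF int]
      by (intro borel_measurable_times borel_measurable_indicator) auto
  qed (use int in \<open>auto simp: indicator_def\<close>)
  then have "\<forall>\<^sub>F n in sequentially. (\<integral>x. indicator (- cball 0 (real n)) x * F x \<partial>power_measure \<sigma>) < \<epsilon>"
    using \<open>0 < \<epsilon>\<close> by (intro order_tendstoD(2)) auto
  then obtain N where "\<And>n. N \<le> n \<Longrightarrow> (\<integral>x. indicator (- cball 0 (real n)) x * F x \<partial>power_measure \<sigma>) < \<epsilon>"
    by (auto simp: eventually_sequentially)
  from that[of "real (Suc N)"] this[of "Suc N"] show thesis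
    by simp
qed

text \<open>
  A dilation changes the integral over \<open>|x| > R\<close> in two ways: it contracts the measure, which costs
  a multiple of the tail itself, and it loses the shell \<open>R < |x| \<le> lR\<close>, whose measure is of order
  \<open>l - 1\<close>. What matters is the common factor \<open>1 - l\<^bsup>-(n-\<sigma>)\<^esup>\<close> and that the other factor is small
  for large \<open>R\<close>.
\<close>

lemma tail_scaling_defect_le:
  fixes F :: "'a::euclidean_space \<Rightarrow> real" and \<sigma> :: real
  defines "c \<equiv> measure (power_measure \<sigma>) (cball 0 1 :: 'a set)"
  assumes fin: "emeasure (power_measure \<sigma>) (cball 0 1 :: 'a set) < \<infinity>"
    and [measurable]: "F \<in> borel_measurable borel" and F: "\<And>x. 0 \<le> F x"
    and int: "integrable (power_measure \<sigma>) F"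
    and R: "0 < R" and l: "1 \<le> l" and M: "\<And>x. R \<le> norm x \<Longrightarrow> F x \<le> M"
  shows "(\<integral>x. indicator (- cball 0 R) x * F x \<partial>power_measure \<sigma>)
         - (\<integral>x. indicator (- cball 0 R) x * F (l *\<^sub>R x) \<partial>power_measure \<sigma>)
       \<le> (1 - l powr - (real DIM('a) - \<sigma>)) *
         ((\<integral>x. indicator (- cball 0 R) x * F x \<partial>power_measure \<sigma>) + M * (c * R powr (real DIM('a) - \<sigma>)))"
proof -
  let ?m = "real DIM('a) - \<sigma>"
  let ?I = "\<lambda>A. \<integral>x. indicator A x * F x \<partial>power_measure \<sigma>"
  define S where "S = (cball 0 (l * R) - cball 0 R :: 'a set)"
  have intA: "integrable (power_measure \<sigma>) (\<lambda>x. indicator A x * F x)" if "A \<in> sets borel" for A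
    using integrable_mult_indicator[OF _ int, of A] that by simp
  have scaled: "(\<integral>x. indicator (- cball 0 R) x * F (l *\<^sub>R x) \<partial>power_measure \<sigma>)
      = l powr - ?m * ?I (- cball 0 (l * R))"
  proof -
    have meas: "(\<lambda>x. indicator (- cball 0 (l * R)) x * F x) \<in> borel_measurable borel"
      by (intro borel_measurable_times borel_measurable_indicator) auto
    have "indicator (- cball 0 R) x = (indicator (- cball 0 (l * R)) (l *\<^sub>R x) :: real)" for x :: 'a
      using l by (auto simp: indicator_def)
    then show ?thesis
      using integral_power_measure_scale(2)[OF meas _ intA, of l] F l by simp
  qed
  have "R \<le> l * R"
    using l R by simp
  then have split: "?I (- cball 0 R) = ?I (- cball 0 (l * R)) + ?I S"
    by (subst Bochner_Integration.integral_add[OF intA intA, symmetric])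
      (auto simp: S_def indicator_def intro!: Bochner_Integration.integral_cong)
  have "?I S \<le> (\<integral>x. M * indicator S x \<partial>power_measure \<sigma>)"
  proof (rule integral_mono)
    show "integrable (power_measure \<sigma>) (\<lambda>x. indicator S x * F x)"
      by (rule intA) (simp add: S_def)
    show "integrable (power_measure \<sigma>) (\<lambda>x. M * indicator S x :: real)"
      using measure_power_measure_shell(1)[OF fin R \<open>R \<le> l * R\<close>]
      by (auto simp: S_def fmeasurable_def less_top)
  qed (auto simp: S_def indicator_def M)
  also have "\<dots> = M * (c * ((l * R) powr ?m - R powr ?m))"
    using measure_power_measure_shell[OF fin R \<open>R \<le> l * R\<close>] by (simp add: S_def c_def)
  also have "(l * R) powr ?m - R powr ?m = (l powr ?m - 1) * R powr ?m"
    using l R by (simp add: powr_mult algebra_simps)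
  finally have "l powr - ?m * ?I S \<le> l powr - ?m * (M * (c * ((l powr ?m - 1) * R powr ?m)))"
    by (intro mult_left_mono) auto
  also have "\<dots> = (l powr - ?m * (l powr ?m - 1)) * (M * (c * R powr ?m))"
    by simp
  also have "l powr - ?m * (l powr ?m - 1) = 1 - l powr - ?m"
    using l by (simp add: right_diff_distrib powr_add[symmetric])
  finally show ?thesis
    unfolding scaled split by (simp add: algebra_simps)
qed

text \<open>
  At \<open>l = 1\<close> the bound is an equality, and \<open>\<eta>\<close> is arbitrary, so this is a bound to
  first order in \<open>l - 1\<close>, with the first-order term that formal differentiation predicts. The radius \<open>R\<close> is chosen first,
  so large that the tail contributes little; then \<open>l\<close> is taken so close to \<open>1\<close> that the ratio
  \<open>u(lx)/u(x)\<close> is uniformly close to \<open>1\<close> for \<open>|x| \<le> R\<close>.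
\<close>

lemma scaled_energy_lower_bound:
  fixes u :: "'a::euclidean_space \<Rightarrow> real"
  assumes pos: "\<And>x. 0 < u x" and cont: "continuous_on UNIV u" and dec: "radially_decreasing u"
    and p: "0 < p" and \<sigma>: "\<sigma> < real DIM('a)"
    and fin: "emeasure (power_measure \<sigma>) (cball 0 1 :: 'a set) < \<infinity>"
    and E: "has_bochner_integral (power_measure \<sigma>) (\<lambda>x. u x powr (p + 1)) E" and \<eta>: "0 < \<eta>"
  shows "\<forall>\<^sub>F l in at_right 1.
      ennreal (E * (p * l powr - (real DIM('a) - \<sigma>) + 1) / (p + 1) - \<eta> * (1 - l powr - (real DIM('a) - \<sigma>)))
      \<le> (\<integral>\<^sup>+x. ennreal (u (l *\<^sub>R x) powr p) * ennreal (u x) \<partial>power_measure \<sigma>)"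
proof -
  let ?m = "real DIM('a) - \<sigma>" and ?\<mu> = "power_measure \<sigma> :: 'a measure"
  define c where "c = measure ?\<mu> (cball 0 1)"
  define F where "F x = u x powr (p + 1)" for x
  define K where "K = 1 / (1 - 2 powr - ?m)"
  \<comment> \<open>The ball, the tail and the boundary of the ball contribute at most \<open>\<epsilon>E\<close>, \<open>\<epsilon>\<close> and \<open>\<epsilon>K\<close>
  to the coefficient of \<open>1 - l\<^bsup>-(n-\<sigma>)\<^esup>\<close>, in sum \<open>\<eta>\<close>.\<close>
  define \<epsilon> where "\<epsilon> = \<eta> / (E + 1 + K)"
  have [measurable]: "u \<in> borel_measurable borel"
    using cont by (rule borel_measurable_continuous_onI)
  then have [measurable]: "F \<in> borel_measurable borel"
    unfolding F_def by measurable
  have int: "integrable ?\<mu> F" and EF: "E = (\<integral>x. F x \<partial>?\<mu>)"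
    using E by (auto simp: has_bochner_integral_iff F_def[abs_def])
  have F: "0 \<le> F x" for x
    by (simp add: F_def)
  have F_mono: "F y \<le> F x" if "norm x \<le> norm y" for x y
    using dec that pos[of y] p unfolding F_def
    by (intro powr_mono2) (auto simp: radially_decreasing_def less_imp_le)
  have "0 \<le> E"
    unfolding EF by (intro integral_nonneg_AE) (simp add: F)
  have m2: "2 powr - ?m < 1"
    using \<sigma> by (intro powr_less_one) auto
  then have "0 < K"
    by (simp add: K_def)
  with \<open>0 \<le> E\<close> \<eta> have "0 < \<epsilon>"
    by (simp add: \<epsilon>_def)
  let ?T = "\<lambda>R. \<integral>x. indicator (- cball 0 R) x * F x \<partial>?\<mu>"
  have intA: "integrable ?\<mu> (\<lambda>x. indicator A x * F x)" if "A \<in> sets borel" for A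
    using integrable_mult_indicator[OF _ int, of A] that by simp
  obtain R0 where R0: "0 < R0" "?T R0 < \<epsilon>"
    using tail_integral_small[OF int \<open>0 < \<epsilon>\<close>] .
  define R where "R = 2 * R0"
  have R: "0 < R" "R0 \<le> R"
    using R0 by (auto simp: R_def)
  have TR: "?T R < \<epsilon>"
  proof (rule le_less_trans[OF _ R0(2)], rule integral_mono)
    show "indicator (- cball 0 R) x * F x \<le> indicator (- cball 0 R0) x * F x" for x
      using R F[of x] by (auto simp: indicator_def)
  qed (auto intro!: intA)
  obtain b :: 'a where b: "b \<in> Basis"
    using nonempty_Basis by blast
  define z where "z = R *\<^sub>R b"
  have z: "norm z = R"
    using b R by (simp add: z_def)
  \<comment> \<open>The decreasing function \<open>F\<close> is at least \<open>F z\<close> on the shell between the radii \<open>R/2\<close> and \<open>R\<close>,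
    which lies in the tail beyond \<open>R/2\<close> and has measure \<open>c R\<^sup>m / K\<close>.\<close>
  have boundary: "F z * (c * R powr ?m) \<le> \<epsilon> * K"
  proof -
    note shell = measure_power_measure_shell[OF fin R0(1) R(2)]
    have "F z * measure ?\<mu> (cball 0 R - cball 0 R0) = (\<integral>x. F z * indicator (cball 0 R - cball 0 R0) x \<partial>?\<mu>)"
      using shell(1) by (simp add: fmeasurable_def)
    also have "\<dots> \<le> ?T R0"
    proof (rule integral_mono)
      show "integrable ?\<mu> (\<lambda>x. F z * indicator (cball 0 R - cball 0 R0) x)"
        using shell(1) by (auto simp: fmeasurable_def less_top)
      show "F z * indicator (cball 0 R - cball 0 R0) x \<le> indicator (- cball 0 R0) x * F x" for x
        using F_mono[of x z] F[of x] z by (auto simp: indicator_def)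
    qed (auto intro!: intA)
    finally have "F z * (c * (R powr ?m - R0 powr ?m)) \<le> \<epsilon>"
      using shell(2) R0(2) by (simp add: c_def)
    also have "R0 powr ?m = R powr ?m * 2 powr - ?m"
      using R0 by (simp add: R_def powr_mult mult.commute mult.left_commute powr_add[symmetric])
    finally have "F z * (c * R powr ?m) * (1 - 2 powr - ?m) \<le> \<epsilon>"
      by (simp add: algebra_simps)
    then show ?thesis
      using m2 by (simp add: K_def pos_le_divide_eq)
  qed
  have "uniformly_continuous_on (cball 0 (2 * R)) u"
    using cont by (intro compact_uniformly_continuous) (auto intro: continuous_on_subset)
  moreover have "0 < \<epsilon> * u z"
    using \<open>0 < \<epsilon>\<close> pos by simp
  ultimately obtain d where "0 < d"
    and d: "\<And>x y. x \<in> cball 0 (2 * R) \<Longrightarrow> y \<in> cball 0 (2 * R) \<Longrightarrow> dist y x < d \<Longrightarrow> dist (u y) (u x) < \<epsilon> * u z"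
    unfolding uniformly_continuous_on_def by metis
  have "ennreal (E * (p * l powr - ?m + 1) / (p + 1) - \<eta> * (1 - l powr - ?m))
      \<le> (\<integral>\<^sup>+x. ennreal (u (l *\<^sub>R x) powr p) * ennreal (u x) \<partial>?\<mu>)"
    if l: "1 < l" "l < 1 + min 1 (d / R)" for l
  proof -
    have "0 < l" "l < 2" "l - 1 < d / R"
      using l by auto
    then have "(l - 1) * R < d"
      using R by (simp only: pos_less_divide_eq)
    have ul: "u (l *\<^sub>R x) \<le> u x" for x
      using dec l mult_right_mono[of 1 l "norm x"] by (auto simp: radially_decreasing_def)
    have Fl: "F (l *\<^sub>R x) \<le> F x" for x
      using l mult_right_mono[of 1 l "norm x"] by (intro F_mono) auto
    note scale = integral_power_measure_scale[OF \<open>F \<in> borel_measurable borel\<close> F int \<open>0 < l\<close>]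
    have intl: "integrable ?\<mu> (\<lambda>x. indicator (- cball 0 R) x * F (l *\<^sub>R x))"
      using integrable_mult_indicator[OF _ scale(1), of "- cball 0 R"] by simp
    define G where "G x = u (l *\<^sub>R x) powr p * u x" for x
    define H where "H x = p / (p + 1) * F (l *\<^sub>R x) + 1 / (p + 1) * F x - \<epsilon> * (F x - F (l *\<^sub>R x))
        - (indicator (- cball 0 R) x * F x - indicator (- cball 0 R) x * F (l *\<^sub>R x))" for x
    have HG: "H x \<le> G x" for x
    proof -
      have "(1 - u (l *\<^sub>R x) / u x) * (F x - F (l *\<^sub>R x)) \<le> (\<epsilon> + indicator (- cball 0 R) x) * (F x - F (l *\<^sub>R x))"
      proof (rule mult_right_mono)
        show "1 - u (l *\<^sub>R x) / u x \<le> \<epsilon> + indicator (- cball 0 R) x"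
        proof (cases "norm x \<le> R")
          case True
          have "l * norm x \<le> 2 * R"
            using True \<open>l < 2\<close> \<open>0 < l\<close> by (intro mult_mono) auto
          moreover have "dist (l *\<^sub>R x) x = (l - 1) * norm x"
            using l by (simp add: dist_norm scaleR_left_diff_distrib[of l 1 x, simplified, symmetric])
          moreover have "(l - 1) * norm x \<le> (l - 1) * R"
            using True l by (intro mult_left_mono) auto
          ultimately have "dist (u (l *\<^sub>R x)) (u x) < \<epsilon> * u z"
            using True R \<open>0 < l\<close> \<open>(l - 1) * R < d\<close> by (intro d) auto
          also have "\<epsilon> * u z \<le> \<epsilon> * u x"
            using dec True z \<open>0 < \<epsilon>\<close> by (intro mult_left_mono) (auto simp: radially_decreasing_def)
          finally show ?thesis
            using pos[of x] True by (simp add: dist_real_def field_simps)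
        next
          case False
          then show ?thesis
            using pos[of x] pos[of "l *\<^sub>R x"] \<open>0 < \<epsilon>\<close> by (simp add: add_increasing)
        qed
      qed (use Fl in simp)
      moreover have "p / (p + 1) * F (l *\<^sub>R x) + 1 / (p + 1) * F x
          - (1 - u (l *\<^sub>R x) / u x) * (F x - F (l *\<^sub>R x)) \<le> G x"
        unfolding F_def G_def by (rule Young_powr_deficit) (use pos ul p in auto)
      ultimately show ?thesis
        by (simp add: H_def algebra_simps)
    qed
    have GF: "G x \<le> F x" for x
      using ul[of x] pos[of x] pos[of "l *\<^sub>R x"] p
      by (auto simp: G_def F_def powr_add less_imp_le intro!: mult_right_mono powr_mono2)
    have G: "0 \<le> G x" for x
      using pos[of x] by (simp add: G_def)
    have [measurable]: "G \<in> borel_measurable borel"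
      unfolding G_def by measurable
    have intG: "integrable ?\<mu> G"
      by (rule Bochner_Integration.integrable_bound[OF int]) (use GF G F in \<open>auto simp: abs_of_nonneg\<close>)
    have "E * (p * l powr - ?m + 1) / (p + 1) - \<eta> * (1 - l powr - ?m)
        \<le> p / (p + 1) * (l powr - ?m * E) + 1 / (p + 1) * E - \<epsilon> * (E - l powr - ?m * E)
          - (1 - l powr - ?m) * (?T R + F z * (c * R powr ?m))"
    proof -
      have "\<epsilon> * E + (?T R + F z * (c * R powr ?m)) \<le> \<epsilon> * (E + 1 + K)"
        using TR boundary by (simp add: algebra_simps)
      also have "\<dots> = \<eta>"
        using \<open>0 \<le> E\<close> \<open>0 < K\<close> by (simp add: \<epsilon>_def)
      finally have "(1 - l powr - ?m) * (\<epsilon> * E + (?T R + F z * (c * R powr ?m))) \<le> (1 - l powr - ?m) * \<eta>"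
        using l \<sigma> powr_mono[of "- ?m" 0 l] by (intro mult_left_mono) auto
      moreover have "E * (p * l powr - ?m + 1) / (p + 1) = p / (p + 1) * (l powr - ?m * E) + 1 / (p + 1) * E"
        using p by (simp add: add_divide_distrib algebra_simps)
      ultimately show ?thesis
        by (simp add: algebra_simps)
    qed
    also have "\<dots> \<le> p / (p + 1) * (l powr - ?m * E) + 1 / (p + 1) * E - \<epsilon> * (E - l powr - ?m * E)
          - (?T R - (\<integral>x. indicator (- cball 0 R) x * F (l *\<^sub>R x) \<partial>?\<mu>))"
      using tail_scaling_defect_le[OF fin \<open>F \<in> borel_measurable borel\<close> F int R(1), of l "F z"]
        F_mono[of z] z l by (simp add: c_def)
    also have "\<dots> = (\<integral>x. H x \<partial>?\<mu>)"
      unfolding H_def using int scale intl intA[of "- cball 0 R"]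
      by (simp add: EF)
    also have "\<dots> \<le> (\<integral>x. G x \<partial>?\<mu>)"
      by (rule integral_mono) (use HG int scale intl intA[of "- cball 0 R"] intG in \<open>simp_all add: H_def\<close>)
    finally have "ennreal (E * (p * l powr - ?m + 1) / (p + 1) - \<eta> * (1 - l powr - ?m))
        \<le> ennreal (\<integral>x. G x \<partial>?\<mu>)"
      by (rule ennreal_leI)
    also have "\<dots> = (\<integral>\<^sup>+x. ennreal (u (l *\<^sub>R x) powr p) * ennreal (u x) \<partial>?\<mu>)"
      using nn_integral_eq_integral[OF intG] G by (simp add: G_def[abs_def] ennreal_mult' ennreal_mult'')
    finally show ?thesis .
  qed
  then show ?thesis
    unfolding eventually_at_right_field using \<open>0 < d\<close> R by (intro exI[of _ "1 + min 1 (d / R)"]) auto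
qed

section \<open>The exponents of a solution of finite energy\<close>

lemma scaled_energy_upper_bound:
  fixes v :: "'a::euclidean_space \<Rightarrow> real"
  assumes pos: "\<And>x. 0 < v x" and [measurable]: "v \<in> borel_measurable borel"
    and q: "0 < q" and l: "0 < l"
    and E: "has_bochner_integral (power_measure \<sigma>) (\<lambda>x. v x powr (q + 1)) E"
  shows "(\<integral>\<^sup>+x. ennreal (v x powr q) * ennreal (v (l *\<^sub>R x)) \<partial>power_measure \<sigma>)
      \<le> ennreal (E * (q + l powr - (real DIM('a) - \<sigma>)) / (q + 1))"
proof -
  let ?\<mu> = "power_measure \<sigma> :: 'a measure"
  define F where "F x = v x powr (q + 1)" for x
  have [measurable]: "F \<in> borel_measurable borel"
    unfolding F_def by measurable
  have F: "0 \<le> F x" for x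
    by (simp add: F_def)
  have int: "integrable ?\<mu> F" and EF: "E = (\<integral>x. F x \<partial>?\<mu>)"
    using E by (auto simp: has_bochner_integral_iff F_def[abs_def])
  note scale = integral_power_measure_scale[OF \<open>F \<in> borel_measurable borel\<close> F int l]
  have "(\<integral>\<^sup>+x. ennreal (v x powr q) * ennreal (v (l *\<^sub>R x)) \<partial>?\<mu>)
      \<le> (\<integral>\<^sup>+x. ennreal (q / (q + 1) * F x + 1 / (q + 1) * F (l *\<^sub>R x)) \<partial>?\<mu>)"
    using Young_powr[OF pos pos q] unfolding F_def
    by (intro nn_integral_mono) (simp add: ennreal_mult'[symmetric] ennreal_leI)
  also have "\<dots> = ennreal (\<integral>x. q / (q + 1) * F x + 1 / (q + 1) * F (l *\<^sub>R x) \<partial>?\<mu>)"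
    using int scale F q by (intro nn_integral_eq_integral) (auto intro!: AE_I2 add_nonneg_nonneg)
  also have "(\<integral>x. q / (q + 1) * F x + 1 / (q + 1) * F (l *\<^sub>R x) \<partial>?\<mu>)
      = E * (q + l powr - (real DIM('a) - \<sigma>)) / (q + 1)"
    using int scale q by (simp add: EF[symmetric] add_divide_distrib algebra_simps)
  finally show ?thesis .
qed

text \<open>
  On the left, the difference of the derivatives at \<open>l = 1\<close> of Young's bounds for the two sides of
  the pairing identity below; on the right, the energy times the amount by which the exponents miss the inequality.
\<close>

lemma pairing_derivative_gap:
  fixes E p q n \<alpha> \<sigma>\<^sub>1 \<sigma>\<^sub>2 :: real
  assumes pq: "0 < p" "0 < q"
  shows "E * (p * (- (n - \<sigma>\<^sub>2))) / (p + 1)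
      - ((\<sigma>\<^sub>2 - \<alpha>) * (E * (q + 1) / (q + 1)) + E * (- (n - \<sigma>\<^sub>1)) / (q + 1))
      = E * ((n - \<sigma>\<^sub>1) / (1 + q) + (n - \<sigma>\<^sub>2) / (1 + p) - (n - \<alpha>))"
proof -
  have "E * (q + 1) / (q + 1) = E"
    using pq by simp
  moreover have "E * (p * (- (n - \<sigma>\<^sub>2))) / (p + 1) = E * ((n - \<sigma>\<^sub>2) / (1 + p)) - E * (n - \<sigma>\<^sub>2)"
  proof -
    have "E * (p * (- (n - \<sigma>\<^sub>2))) = E * (n - \<sigma>\<^sub>2) - E * (n - \<sigma>\<^sub>2) * (1 + p)"
      by (simp add: algebra_simps)
    then show ?thesis
      using pq by (simp add: add.commute[of p 1] diff_divide_distrib[of _ "E * (n - \<sigma>\<^sub>2) * (1 + p)"])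
  qed
  moreover have "E * (- (n - \<sigma>\<^sub>1)) / (q + 1) = - (E * ((n - \<sigma>\<^sub>1) / (1 + q)))"
    by (simp only: mult_minus_right minus_divide_left times_divide_eq_right add.commute[of q 1])
  ultimately show ?thesis
    by (simp only: distrib_left right_diff_distrib left_diff_distrib mult.commute)
qed

text \<open>
  Both sides are the double integral of \<open>f(lx) g(y) |x-y|\<^bsup>\<alpha>-n\<^esup>\<close>; on the right, \<open>lx\<close> has been made
  the variable. For the system, where \<open>f = u\<^sup>p\<close> and \<open>g = v\<^sup>q\<close>, formal differentiation at
  \<open>l = 1\<close> turns this into the Pohozaev identity.
\<close>

lemma riesz_pairing_scale:
  fixes f g u v :: "'a::euclidean_space \<Rightarrow> real"
  assumes [measurable]: "f \<in> borel_measurable borel" "g \<in> borel_measurable borel"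
    and f: "\<And>x. 0 \<le> f x" and g: "\<And>x. 0 \<le> g x"
    and u: "\<And>x. (\<integral>\<^sup>+y. ennreal (g y * norm (x - y) powr (\<alpha> - real DIM('a))) \<partial>power_measure \<sigma>\<^sub>1) = ennreal (u x)"
    and v: "\<And>y. (\<integral>\<^sup>+x. ennreal (f x * norm (y - x) powr (\<alpha> - real DIM('a))) \<partial>power_measure \<sigma>\<^sub>2) = ennreal (v y)"
    and l: "0 < l"
  shows "(\<integral>\<^sup>+x. ennreal (f (l *\<^sub>R x)) * ennreal (u x) \<partial>power_measure \<sigma>\<^sub>2)
      = ennreal (l powr (\<sigma>\<^sub>2 - \<alpha>)) * (\<integral>\<^sup>+y. ennreal (g y) * ennreal (v (l *\<^sub>R y)) \<partial>power_measure \<sigma>\<^sub>1)"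
proof -
  let ?e = "\<alpha> - real DIM('a)"
  interpret P: pair_sigma_finite "power_measure \<sigma>\<^sub>1 :: 'a measure" "power_measure \<sigma>\<^sub>2 :: 'a measure"
    by (simp add: pair_sigma_finite_def sigma_finite_power_measure)
  have "(\<integral>\<^sup>+x. ennreal (f (l *\<^sub>R x)) * ennreal (u x) \<partial>power_measure \<sigma>\<^sub>2)
      = (\<integral>\<^sup>+x. \<integral>\<^sup>+y. ennreal (f (l *\<^sub>R x)) * ennreal (g y * norm (x - y) powr ?e) \<partial>power_measure \<sigma>\<^sub>1 \<partial>power_measure \<sigma>\<^sub>2)"
    by (simp add: u[symmetric] nn_integral_cmult)
  also have "\<dots> = (\<integral>\<^sup>+y. \<integral>\<^sup>+x. ennreal (f (l *\<^sub>R x)) * ennreal (g y * norm (x - y) powr ?e) \<partial>power_measure \<sigma>\<^sub>2 \<partial>power_measure \<sigma>\<^sub>1)"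
    by (rule P.Fubini') measurable
  also have "\<dots> = (\<integral>\<^sup>+y. ennreal (l powr (\<sigma>\<^sub>2 - \<alpha>)) * (ennreal (g y) * ennreal (v (l *\<^sub>R y))) \<partial>power_measure \<sigma>\<^sub>1)"
  proof (intro nn_integral_cong)
    fix y :: 'a
    have shift: "norm (x - y) powr ?e = l powr - ?e * norm (l *\<^sub>R y - l *\<^sub>R x) powr ?e" for x
    proof -
      have "norm (l *\<^sub>R y - l *\<^sub>R x) = l * norm (x - y)"
        using l by (simp add: scaleR_diff_right[symmetric] norm_minus_commute)
      then show ?thesis
        using l by (simp add: powr_mult mult.assoc[symmetric] powr_add[symmetric])
    qed
    have "(\<integral>\<^sup>+x. ennreal (f (l *\<^sub>R x)) * ennreal (g y * norm (x - y) powr ?e) \<partial>power_measure \<sigma>\<^sub>2)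
        = (\<integral>\<^sup>+x. ennreal (g y * l powr - ?e) *
            ennreal (f (l *\<^sub>R x) * norm (l *\<^sub>R y - l *\<^sub>R x) powr ?e) \<partial>power_measure \<sigma>\<^sub>2)"
      using f g by (auto simp: shift ennreal_mult'[symmetric] mult_ac intro!: nn_integral_cong)
    also have "\<dots> = ennreal (g y * l powr - ?e) * (ennreal (l powr - (real DIM('a) - \<sigma>\<^sub>2)) * ennreal (v (l *\<^sub>R y)))"
      using nn_integral_power_measure_scale[OF _ l,
          of "\<lambda>z. ennreal (f z * norm (l *\<^sub>R y - z) powr ?e)" \<sigma>\<^sub>2]
      by (simp add: nn_integral_cmult v)
    also have "\<dots> = ennreal (l powr - ?e * l powr - (real DIM('a) - \<sigma>\<^sub>2)) * (ennreal (g y) * ennreal (v (l *\<^sub>R y)))"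
      using g by (simp add: ennreal_mult' mult_ac)
    also have "l powr - ?e * l powr - (real DIM('a) - \<sigma>\<^sub>2) = l powr (\<sigma>\<^sub>2 - \<alpha>)"
      by (simp add: powr_add[symmetric])
    finally show "(\<integral>\<^sup>+x. ennreal (f (l *\<^sub>R x)) * ennreal (g y * norm (x - y) powr ?e) \<partial>power_measure \<sigma>\<^sub>2)
        = ennreal (l powr (\<sigma>\<^sub>2 - \<alpha>)) * (ennreal (g y) * ennreal (v (l *\<^sub>R y)))" .
  qed
  also have "\<dots> = ennreal (l powr (\<sigma>\<^sub>2 - \<alpha>)) * (\<integral>\<^sup>+y. ennreal (g y) * ennreal (v (l *\<^sub>R y)) \<partial>power_measure \<sigma>\<^sub>1)"
  proof (rule nn_integral_cmult)
    have "(\<lambda>y. \<integral>\<^sup>+x. ennreal (f x * norm (y - x) powr ?e) \<partial>power_measure \<sigma>\<^sub>2) \<in> borel_measurable borel"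
      by measurable
    then have [measurable]: "(\<lambda>y. ennreal (v y)) \<in> borel_measurable borel"
      by (simp add: v)
    have "(\<lambda>y. ennreal (v (l *\<^sub>R y))) \<in> borel_measurable borel"
      by measurable
    then show "(\<lambda>y. ennreal (g y) * ennreal (v (l *\<^sub>R y))) \<in> borel_measurable (power_measure \<sigma>\<^sub>1)"
      by simp
  qed
  finally show ?thesis .
qed

text \<open>
  The pairing identity, bounded below on its left and above on its right, says that a function
  \<open>f\<close> with \<open>f(1) = 0\<close> is nonpositive just to the right of \<open>1\<close>, whereas its derivative there is
  \<open>E \<kappa> - \<eta> (n-\<sigma>\<^sub>2)\<close>, where \<open>\<kappa>\<close> is the amount by which the asserted inequality fails.
\<close>

lemma riesz_system_finite_energy_exponents:
  fixes u v :: "'a::euclidean_space \<Rightarrow> real"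
  defines "n \<equiv> real DIM('a)"
  assumes pos: "\<And>x. 0 < u x" "\<And>x. 0 < v x"
    and cont: "continuous_on UNIV u" and [measurable]: "v \<in> borel_measurable borel"
    and dec: "radially_decreasing u" and pq: "0 < p" "0 < q" and \<sigma>: "\<sigma>\<^sub>2 < n"
    and fin: "emeasure (power_measure \<sigma>\<^sub>2) (cball 0 1 :: 'a set) < \<infinity>"
    and u: "\<And>x. (\<integral>\<^sup>+y. ennreal (v y powr q * norm (x - y) powr (\<alpha> - n)) \<partial>power_measure \<sigma>\<^sub>1) = ennreal (u x)"
    and v: "\<And>x. (\<integral>\<^sup>+y. ennreal (u y powr p * norm (x - y) powr (\<alpha> - n)) \<partial>power_measure \<sigma>\<^sub>2) = ennreal (v x)"
    and energy: "(\<integral>\<^sup>+x. ennreal (u x powr (p + 1)) \<partial>power_measure \<sigma>\<^sub>2) < \<infinity>"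
  shows "(n - \<sigma>\<^sub>1) / (1 + q) + (n - \<sigma>\<^sub>2) / (1 + p) \<le> n - \<alpha>"
proof (rule ccontr)
  assume contr: "\<not> ?thesis"
  define \<kappa> where "\<kappa> = (n - \<sigma>\<^sub>1) / (1 + q) + (n - \<sigma>\<^sub>2) / (1 + p) - (n - \<alpha>)"
  have "0 < \<kappa>"
    using contr by (simp add: \<kappa>_def)
  let ?m1 = "n - \<sigma>\<^sub>1" and ?m2 = "n - \<sigma>\<^sub>2"
  have [measurable]: "u \<in> borel_measurable borel"
    using cont by (rule borel_measurable_continuous_onI)
  define E where "E = (\<integral>x. u x powr (p + 1) \<partial>power_measure \<sigma>\<^sub>2)"
  have int_u: "integrable (power_measure \<sigma>\<^sub>2) (\<lambda>x. u x powr (p + 1))"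
    using energy by (intro integrableI_nonneg) auto
  then have Eu: "has_bochner_integral (power_measure \<sigma>\<^sub>2) (\<lambda>x. u x powr (p + 1)) E"
    by (simp add: has_bochner_integral_iff E_def)
  have pairing: "(\<integral>\<^sup>+x. ennreal (u (l *\<^sub>R x) powr p) * ennreal (u x) \<partial>power_measure \<sigma>\<^sub>2)
      = ennreal (l powr (\<sigma>\<^sub>2 - \<alpha>)) * (\<integral>\<^sup>+y. ennreal (v y powr q) * ennreal (v (l *\<^sub>R y)) \<partial>power_measure \<sigma>\<^sub>1)"
    if "0 < l" for l
    using that u v
    by (intro riesz_pairing_scale[where f = "\<lambda>x. u x powr p" and g = "\<lambda>x. v x powr q"]) (auto simp: n_def)
  have Ev: "has_bochner_integral (power_measure \<sigma>\<^sub>1) (\<lambda>x. v x powr (q + 1)) E"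
  proof (rule has_bochner_integral_nn_integral)
    have "(\<integral>\<^sup>+x. ennreal (v x powr (q + 1)) \<partial>power_measure \<sigma>\<^sub>1)
        = (\<integral>\<^sup>+x. ennreal (u x powr (p + 1)) \<partial>power_measure \<sigma>\<^sub>2)"
      using pairing[of 1] pos by (simp add: powr_add ennreal_mult' less_imp_le)
    also have "\<dots> = ennreal E"
      unfolding E_def by (rule nn_integral_eq_integral[OF int_u]) simp
    finally show "(\<integral>\<^sup>+x. ennreal (v x powr (q + 1)) \<partial>power_measure \<sigma>\<^sub>1) = ennreal E" .
    show "0 \<le> E"
      unfolding E_def by (intro integral_nonneg_AE) simp
  qed auto
  have "E \<noteq> 0"
  proof
    assume "E = 0"
    then have "AE x in power_measure \<sigma>\<^sub>2. u x powr (p + 1) = 0"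
      using integral_nonneg_eq_0_iff_AE[OF int_u] by (simp add: E_def)
    then have "AE x in power_measure \<sigma>\<^sub>2. x \<notin> (cball 0 1 :: 'a set)"
      by eventually_elim (use pos in \<open>simp add: less_imp_neq[symmetric]\<close>)
    then have "emeasure (power_measure \<sigma>\<^sub>2) (cball 0 1 :: 'a set) = 0"
      by (subst (asm) AE_iff_measurable[OF _ refl]) (auto simp: cball_def)
    then show False
      using emeasure_power_measure_cball_pos[of \<sigma>\<^sub>2, where 'a='a] by simp
  qed
  moreover have "0 \<le> E"
    unfolding E_def by (intro integral_nonneg_AE) simp
  ultimately have "0 < E"
    by simp
  \<comment> \<open>This error term takes away half of the derivative \<open>E \<kappa>\<close>.\<close>
  define \<eta> where "\<eta> = E * \<kappa> / (2 * ?m2)"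
  have "0 < \<eta>"
    using \<open>0 < E\<close> \<open>0 < \<kappa>\<close> \<sigma> by (simp add: \<eta>_def)
  define f where "f l = E * (p * l powr - ?m2 + 1) / (p + 1) - \<eta> * (1 - l powr - ?m2)
      - l powr (\<sigma>\<^sub>2 - \<alpha>) * (E * (q + l powr - ?m1) / (q + 1))" for l
  have "\<forall>\<^sub>F l in at_right 1. f l \<le> 0"
    using scaled_energy_lower_bound[OF pos(1) cont dec pq(1) \<sigma>[unfolded n_def] fin Eu \<open>0 < \<eta>\<close>]
      eventually_at_right_less[of "1::real"]
  proof eventually_elim
    case (elim l)
    then have "0 < l"
      by simp
    note elim(1)
    also have "(\<integral>\<^sup>+x. ennreal (u (l *\<^sub>R x) powr p) * ennreal (u x) \<partial>power_measure \<sigma>\<^sub>2)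
      \<le> ennreal (l powr (\<sigma>\<^sub>2 - \<alpha>)) * ennreal (E * (q + l powr - ?m1) / (q + 1))"
      unfolding pairing[OF \<open>0 < l\<close>] n_def
      by (intro mult_left_mono scaled_energy_upper_bound) (use pos pq \<open>0 < l\<close> Ev in auto)
    also have "\<dots> = ennreal (l powr (\<sigma>\<^sub>2 - \<alpha>) * (E * (q + l powr - ?m1) / (q + 1)))"
      by (rule ennreal_mult'[symmetric]) simp
    finally show "f l \<le> 0"
      using pq \<open>0 < E\<close> by (subst (asm) ennreal_le_iff) (auto simp: f_def n_def)
  qed
  then obtain b where b: "1 < b" "\<And>l. 1 < l \<Longrightarrow> l < b \<Longrightarrow> f l \<le> 0"
    unfolding eventually_at_right_field by blast
  have "(f has_real_derivative E * (p * (- ?m2)) / (p + 1) - \<eta> * ?m2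
      - ((\<sigma>\<^sub>2 - \<alpha>) * (E * (q + 1) / (q + 1)) + E * (- ?m1) / (q + 1))) (at 1)"
    unfolding f_def[abs_def] using pq
    by (auto intro!: derivative_eq_intros) (simp add: add_divide_distrib mult_ac)
  also have "E * (p * (- ?m2)) / (p + 1) - \<eta> * ?m2
      - ((\<sigma>\<^sub>2 - \<alpha>) * (E * (q + 1) / (q + 1)) + E * (- ?m1) / (q + 1)) = E * \<kappa> / 2"
  proof -
    have "\<eta> * ?m2 = E * \<kappa> / 2"
      using \<sigma> by (simp add: \<eta>_def del: right_diff_distrib_numeral)
    with pairing_derivative_gap[OF pq, of E n \<sigma>\<^sub>2 \<alpha> \<sigma>\<^sub>1, folded \<kappa>_def]
    show ?thesis
      by linarith
  qed
  finally have "(f has_real_derivative E * \<kappa> / 2) (at 1)" .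
  then obtain d where "0 < d" and d: "\<And>h. 0 < h \<Longrightarrow> h < d \<Longrightarrow> f 1 < f (1 + h)"
    using DERIV_pos_inc_right[of f "E * \<kappa> / 2" 1] \<open>0 < E\<close> \<open>0 < \<kappa>\<close> by auto
  have "f 1 = 0"
    using pq by (simp add: f_def)
  define h where "h = min d (b - 1) / 2"
  have "0 < h" "h < d" "1 + h < b"
    unfolding h_def using \<open>0 < d\<close> b(1) by (simp_all add: min_def field_simps)
  then have "f 1 < f (1 + h)" "f (1 + h) \<le> 0"
    using d[of h] b(2)[of "1 + h"] by auto
  with \<open>f 1 = 0\<close> show False
    by simp
qed

section \<open>Nonexistence of positive radial solutions\<close>

theorem theorem5:
  fixes p q \<alpha> \<sigma>\<^sub>1 \<sigma>\<^sub>2 :: real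
  assumes "CARD('n::finite) \<ge> 3"
    and "p > 0" and "q > 0"
    and "2 \<le> \<alpha>" and "\<alpha> < real CARD('n)"
    and "\<sigma>\<^sub>1 < \<alpha>" and "\<sigma>\<^sub>2 < \<alpha>"
    and "(0 < p * q \<and> p * q \<le> 1) \<or>
         (p * q > 1 \<and>
          (real CARD('n) - \<sigma>\<^sub>1) / (1 + q) + (real CARD('n) - \<sigma>\<^sub>2) / (1 + p) > real CARD('n) - \<alpha>)"
  shows "\<not> (\<exists>u v :: real ^ 'n \<Rightarrow> real. positive_radial_solution p q \<alpha> \<sigma>\<^sub>1 \<sigma>\<^sub>2 u v)"
proof
  assume "\<exists>u v :: real ^ 'n \<Rightarrow> real. positive_radial_solution p q \<alpha> \<sigma>\<^sub>1 \<sigma>\<^sub>2 u v"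
  then obtain u v :: "real ^ 'n \<Rightarrow> real" where sol: "positive_radial_solution p q \<alpha> \<sigma>\<^sub>1 \<sigma>\<^sub>2 u v"
    by blast
  then have pos: "\<And>x. 0 < u x" "\<And>x. 0 < v x"
    and dec: "radially_decreasing u" "radially_decreasing v"
    and cont: "continuous_on UNIV u" "continuous_on UNIV v"
    by (auto simp: positive_radial_solution_def)
  then have [measurable]: "u \<in> borel_measurable borel" "v \<in> borel_measurable borel"
    by (auto intro: borel_measurable_continuous_onI)
  have riesz: "riesz_equation \<alpha> \<sigma>\<^sub>1 q v u" "riesz_equation \<alpha> \<sigma>\<^sub>2 p u v"
    using sol by (simp_all add: positive_radial_solution_def)
  have u: "(\<integral>\<^sup>+y. ennreal (v y powr q * norm (x - y) powr (\<alpha> - real DIM(real ^ 'n))) \<partial>power_measure \<sigma>\<^sub>1)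
        = ennreal (u x)"
    and v: "(\<integral>\<^sup>+y. ennreal (u y powr p * norm (x - y) powr (\<alpha> - real DIM(real ^ 'n))) \<partial>power_measure \<sigma>\<^sub>2)
        = ennreal (v x)" for x
    by (rule nn_integral_riesz_equation[OF riesz(1)] nn_integral_riesz_equation[OF riesz(2)]; measurable)+
  have n: "\<alpha> < real DIM(real ^ 'n)"
    using assms(5) by simp
  note bound_u = riesz_potential_lower_bound[OF u pos(2) pos(1) dec(2) assms(3) n]
    and bound_v = riesz_potential_lower_bound[OF v pos(1) pos(2) dec(1) assms(2) n]
  define A where "A = (\<alpha> - \<sigma>\<^sub>1) + q * (\<alpha> - \<sigma>\<^sub>2)"
  have "0 < A"
    using assms by (simp add: A_def add_pos_pos)
  have improve: "\<exists>k>0. \<forall>x. x \<noteq> 0 \<longrightarrow> k * norm x powr A * u x powr (p * q) \<le> u x"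
    unfolding A_def by (rule mutual_lower_bounds_compose[OF bound_u(2) bound_v(2) assms(3)])
  have u0: "u x \<le> u 0" for x
    using dec(1) by (simp add: radially_decreasing_def)
  from assms(8) show False
  proof
    assume "0 < p * q \<and> p * q \<le> 1"
    then show False
      using no_bounded_self_improving[OF improve pos(1) u0 \<open>0 < A\<close>] by simp
  next
    assume *: "p * q > 1 \<and>
      (real CARD('n) - \<sigma>\<^sub>1) / (1 + q) + (real CARD('n) - \<sigma>\<^sub>2) / (1 + p) > real CARD('n) - \<alpha>"
    then have pq: "1 < p * q"
      by simp
    define s where "s = A / (p * q - 1) * (p + 1)"
    obtain C where "0 < C" and C: "\<And>x. x \<noteq> 0 \<Longrightarrow> u x \<le> C * norm x powr - (A / (p * q - 1))"
      using self_improving_decay[OF improve pos(1) pq] by blast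
    have decay: "u x powr (p + 1) \<le> C powr (p + 1) * norm x powr - s" if "x \<noteq> 0" for x
    proof -
      have "u x powr (p + 1) \<le> (C * norm x powr - (A / (p * q - 1))) powr (p + 1)"
        using C[OF that] pos(1)[of x] assms(2) by (intro powr_mono2) auto
      then show ?thesis
        using \<open>0 < C\<close> by (simp add: s_def powr_mult powr_powr)
    qed
    \<comment> \<open>Clearing denominators, the hypothesis on the exponents says exactly that \<open>u\<^bsup>p+1\<^esup>\<close> decays
    faster than the critical rate.\<close>
    have "real CARD('n) - \<sigma>\<^sub>2 < s"
    proof -
      let ?N = "real CARD('n)"
      have "(?N - \<alpha>) * ((1 + q) * (1 + p))
          < ((?N - \<sigma>\<^sub>1) / (1 + q) + (?N - \<sigma>\<^sub>2) / (1 + p)) * ((1 + q) * (1 + p))"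
        using * assms by (intro mult_strict_right_mono) auto
      also have "\<dots> = (?N - \<sigma>\<^sub>1) * (1 + p) + (?N - \<sigma>\<^sub>2) * (1 + q)"
        using assms by (simp add: divide_simps)
      finally have "(?N - \<sigma>\<^sub>2) * (p * q - 1) < A * (p + 1)"
        by (simp add: A_def algebra_simps)
      then show ?thesis
        using pq by (simp add: s_def field_simps)
    qed
    have "(\<integral>\<^sup>+x. ennreal (u x powr (p + 1)) \<partial>power_measure \<sigma>\<^sub>2) < \<infinity>"
    proof (rule nn_integral_power_measure_decay_finite[OF _ bound_v(1) _ decay])
      show "u x powr (p + 1) \<le> u 0 powr (p + 1)" for x
        using u0[of x] pos(1)[of x] assms(2) by (intro powr_mono2) auto
      show "0 < s"
        using \<open>real CARD('n) - \<sigma>\<^sub>2 < s\<close> assms by linarith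
    qed (use \<open>real CARD('n) - \<sigma>\<^sub>2 < s\<close> in auto)
    then have "(real DIM(real ^ 'n) - \<sigma>\<^sub>1) / (1 + q) + (real DIM(real ^ 'n) - \<sigma>\<^sub>2) / (1 + p)
        \<le> real DIM(real ^ 'n) - \<alpha>"
      using assms
      by (intro riesz_system_finite_energy_exponents[OF pos cont(1) _ dec(1) assms(2,3) _ bound_v(1) u v]) auto
    with * show False
      by simp
  qed
qed

end
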